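(* Let $m$ be a positive integer, let $\Delta$ be a simplicial complex on $[m]$ and let $G$ be a simple undirected graph with vertex set $[m]$. The map $\phi_\Delta$ is surjective onto $\mathbb{S}^m_{\succeq 0}(G)$ (that is, $\operatorname{im}(\phi_\Delta)=\mathbb{S}^m_{\succeq 0}(G)$) if and only if $G$ is chordal and $\Delta$ is the clique complex of $G$.
   Context: Notation: $[m]=\{1,\dots,m\}$. A simplicial complex on $[m]$ is a collection $\Delta\subseteq 2^{[m]}$ closed under taking subsets, whose union of faces is $[m]$ (so all singletons are faces). $\mathbb{S}^m_{\succeq 0}$ is the cone of real symmetric positive semidefinite $m\times m$ matrices, and $\mathbb{S}^m_{\succeq 0}(G)$ is the subcone of matrices $(\sigma_{ij})\in\mathbb{S}^m_{\succeq 0}$ with $\sigma_{ij}=0$ whenever $i\neq j$ and $\{i,j\}$ is not an edge of $G$. The map $\phi_\Delta:\prod_{F\in\Delta}\mathbb{R}^{|F|}\to\mathbb{S}^m_{\succeq 0}$ is defined by $\phi_\Delta(\gamma)=\Gamma(\gamma)\Gamma(\gamma)^T$, where for $\gamma=(\gamma_{i,F}: F\in\Delta,\ i\in F)$ the $[m]\times\Delta$ matrix $\Gamma(\gamma)$ has entries $\Gamma(\gamma)_{i,F}=\gamma_{i,F}$ if $i\in F$ and $0$ otherwise. A clique of $G$ is a subset $F\subseteq[m]$ such that any two distinct vertices of $F$ are joined by an edge; the clique complex of $G$ is the simplicial complex of all cliques. A graph is chordal if it contains no chordless cycle of size more than three as an induced subgraph. *)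

theory Defs
  imports "HOL-Analysis.Analysis" "HOL-Library.Ramsey"
begin

text \<open>
  The vertex set \<open>[m]\<close> is rendered as an arbitrary finite type \<open>'m\<close>, with \<open>m = CARD('m)\<close>;
  HOL types are nonempty, so \<open>m \<ge> 1\<close>. Faces, cliques and edges are values of type \<open>'m set\<close>.
\<close>

definition is_simplicial_complex :: "'m set set \<Rightarrow> bool" where
  "is_simplicial_complex \<Delta> \<longleftrightarrow> (\<forall>F\<in>\<Delta>. \<forall>F'\<subseteq>F. F' \<in> \<Delta>) \<and> \<Union>\<Delta> = UNIV"

text \<open>A simple undirected graph with vertex set \<open>UNIV\<close> is given by its set of two-element edges.\<close>

definition is_simple_graph :: "'m set set \<Rightarrow> bool" where
  "is_simple_graph E \<longleftrightarrow> (\<forall>e\<in>E. card e = 2)"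

definition clique_complex :: "'m set set \<Rightarrow> 'm set set" where
  "clique_complex E = {F. clique F E}"

text \<open>
  A chordless cycle is a list of at least three distinct vertices whose induced subgraph is the
  cycle visiting them in this order: two entries are adjacent exactly when their positions are
  cyclically consecutive.
\<close>

definition is_chordless_cycle :: "'m set set \<Rightarrow> 'm list \<Rightarrow> bool" where
  "is_chordless_cycle E c \<longleftrightarrow> distinct c \<and> 3 \<le> length c \<and>
    (\<forall>a<length c. \<forall>b<length c.
       {c ! a, c ! b} \<in> E \<longleftrightarrow> b = Suc a mod length c \<or> a = Suc b mod length c)"

definition is_chordal :: "'m set set \<Rightarrow> bool" where
  "is_chordal E \<longleftrightarrow> \<not> (\<exists>c. is_chordless_cycle E c \<and> 3 < length c)"

definition psd_cone :: "(real^'m^'m::finite) set" where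
  "psd_cone = {S. transpose S = S \<and> (\<forall>x. 0 \<le> x \<bullet> (S *v x))}"

definition psd_cone_graph :: "'m set set \<Rightarrow> (real^'m^'m::finite) set" where
  "psd_cone_graph E = {S \<in> psd_cone. \<forall>i j. i \<noteq> j \<and> {i, j} \<notin> E \<longrightarrow> S $ i $ j = 0}"

text \<open>
  The parameter space is the product over \<open>F \<in> \<Delta>\<close> of \<open>\<real>\<^sup>F\<close>; the parameter \<open>\<gamma>\<^sub>i\<^sub>,\<^sub>F\<close> is \<open>\<gamma> F i\<close>.
\<close>

definition param_space :: "'m set set \<Rightarrow> ('m set \<Rightarrow> 'm \<Rightarrow> real) set" where
  "param_space \<Delta> = (\<Pi>\<^sub>E F\<in>\<Delta>. (\<Pi>\<^sub>E i\<in>F. UNIV))"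

text \<open>
  Matrix dimensions are types, so the columns are indexed by all subsets of the vertex set and not
  only by \<open>\<Delta>\<close>; the extra columns are zero and do not contribute to \<open>\<Gamma> \<Gamma>\<^sup>T\<close>.
\<close>

definition Gamma_matrix ::
    "'m set set \<Rightarrow> ('m set \<Rightarrow> 'm \<Rightarrow> real) \<Rightarrow> real^('m::finite set)^'m" where
  "Gamma_matrix \<Delta> \<gamma> = (\<chi> i F. if F \<in> \<Delta> \<and> i \<in> F then \<gamma> F i else 0)"

definition phi :: "'m set set \<Rightarrow> ('m set \<Rightarrow> 'm \<Rightarrow> real) \<Rightarrow> real^'m^'m::finite" where
  "phi \<Delta> \<gamma> = Gamma_matrix \<Delta> \<gamma> ** transpose (Gamma_matrix \<Delta> \<gamma>)"

end

theory Submission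
  imports Defs
begin

text \<open>A matrix lies in the image of \<phi> exactly when it is a sum of rank-one matrices
  \<open>v_F v_F^T\<close>, one per face \<open>F\<close>, with \<open>v_F\<close> supported on
  \<open>F\<close> (\<open>image_phi_iff\<close>).

  Suppose \<Delta> consists of the cliques of a chordal graph. Each summand respects the zero
  pattern, so the image lies in the cone. For the other inclusion, Dirac's theorem
  (\<open>chordal_simplicial_vertex\<close>) supplies a vertex whose closed neighbourhood is a
  clique. One step of Cholesky elimination at this vertex splits off a rank-one matrix supported on
  that clique, and the Schur complement keeps the zero pattern. Iterating gives
  \<open>chordal_psd_decomposition\<close>.

  Conversely, suppose the image is the whole cone. The rank-one matrix of the indicator vector of a
  set \<open>F\<close> tests both inclusions between \<Delta> and the clique complex
  (\<open>subset_clique_complex_if_image_phi_subset\<close>,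
  \<open>clique_complex_subset_if_subset_image_phi\<close>). A chordless cycle of length
  \<open>n > 3\<close> carries a positive semidefinite matrix of rank \<open>n - 2\<close> with the
  right zeros that is no sum of clique-supported rank-one matrices
  (\<open>chordless_cycle_not_decomposable\<close>). The tool for ruling out decompositions is
  \<open>gram_eq_orthogonal\<close>: summands of a positive semidefinite matrix are orthogonal to
  its kernel.\<close>

section \<open>Chordal graphs and simplicial vertices\<close>

text \<open>A walk of least length works, since a repeated vertex or an edge skipping ahead would
  shorten it. For a symmetric irreflexive relation this is an induced path.\<close>

lemma shortest_relpow_path:
  assumes "(a, b) \<in> R\<^sup>*"
  obtains f n where "f 0 = a" "f n = b" "\<And>i. i < n \<Longrightarrow> (f i, f (Suc i)) \<in> R"
    "inj_on f {..n}" "\<And>i j. Suc i < j \<Longrightarrow> j \<le> n \<Longrightarrow> (f i, f j) \<notin> R"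
proof -
  define n where "n = (LEAST n. (a, b) \<in> R ^^ n)"
  have ex: "\<exists>n. (a, b) \<in> R ^^ n"
    using assms rtrancl_imp_relpow by fast
  have "(a, b) \<in> R ^^ n"
    unfolding n_def by (rule LeastI_ex[OF ex])
  then obtain f where f: "f 0 = a" "f n = b" "\<And>i. i < n \<Longrightarrow> (f i, f (Suc i)) \<in> R"
    unfolding relpow_fun_conv by auto
  have minimal: "n \<le> k" if "(a, b) \<in> R ^^ k" for k
    unfolding n_def using that by (rule Least_le)
  have start: "(a, f i) \<in> R ^^ i" if "i \<le> n" for i
    unfolding relpow_fun_conv using that f by (intro exI[of _ f]) auto
  have rest: "(f j, b) \<in> R ^^ (n - j)" if "j \<le> n" for j
    unfolding relpow_fun_conv using that f by (intro exI[of _ "\<lambda>i. f (j + i)"]) auto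
  have no_repeat: "f i \<noteq> f j" if "i < j" "j \<le> n" for i j
  proof
    assume "f i = f j"
    then have "(a, b) \<in> R ^^ (i + (n - j))"
      using start[of i] rest[of j] that unfolding relpow_add by auto
    then show False
      using minimal that by fastforce
  qed
  have no_shortcut: "(f i, f j) \<notin> R" if "Suc i < j" "j \<le> n" for i j
  proof
    assume "(f i, f j) \<in> R"
    then have "(a, f j) \<in> R ^^ Suc i"
      using start[of i] that by auto
    then have "(a, b) \<in> R ^^ (Suc i + (n - j))"
      using rest[of j] that unfolding relpow_add by blast
    then show False
      using minimal that by fastforce
  qed
  have "inj_on f {..n}"
    by (intro linorder_inj_onI) (use no_repeat in auto)
  with f no_shortcut that show ?thesis
    by blast
qed

text \<open>Otherwise a shortest path from \<open>a\<close> to \<open>b\<close> has length at least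
  two and its interior lies in \<open>C\<close>, where \<open>x\<close> has no neighbours. Closing
  it through \<open>x\<close> gives a chordless cycle on at least four vertices.\<close>

lemma chordal_common_neighbour:
  assumes chordal: "is_chordal E" and simple: "is_simple_graph E"
    and xa: "{x, a} \<in> E" and xb: "{x, b} \<in> E" and "a \<noteq> b"
    and far: "\<And>c. c \<in> C \<Longrightarrow> c \<noteq> x \<and> {x, c} \<notin> E"
    and path: "(a, b) \<in> {(u, v). u \<in> insert a (insert b C) \<and> v \<in> insert a (insert b C) \<and> {u, v} \<in> E}\<^sup>*"
  shows "{a, b} \<in> E"
proof (rule ccontr)
  assume ab: "{a, b} \<notin> E"
  define R where "R = {(u, v). u \<in> insert a (insert b C) \<and> v \<in> insert a (insert b C) \<and> {u, v} \<in> E}"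
  obtain f n where f: "f 0 = a" "f n = b" "\<And>i. i < n \<Longrightarrow> (f i, f (Suc i)) \<in> R"
    "inj_on f {..n}" "\<And>i j. Suc i < j \<Longrightarrow> j \<le> n \<Longrightarrow> (f i, f j) \<notin> R"
    using shortest_relpow_path[OF path[folded R_def]] by metis
  have loop: "{v} \<notin> E" for v
    using simple unfolding is_simple_graph_def by fastforce
  have "x \<noteq> a" "x \<noteq> b"
    using xa xb loop by auto
  have n2: "2 \<le> n"
  proof (rule ccontr)
    assume "\<not> 2 \<le> n"
    then consider "n = 0" | "n = 1" by linarith
    then show False
      using f(1-3) \<open>a \<noteq> b\<close> ab by cases (auto simp: R_def)
  qed
  have f_mem: "f i \<in> insert a (insert b C)" if "i \<le> n" for i
    using f(1-3) that by (cases "i = n") (auto simp: R_def)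
  have f_inner: "f i \<in> C" if "0 < i" "i < n" for i
  proof -
    have "f i \<noteq> f 0" "f i \<noteq> f n"
      using that inj_onD[OF f(4)] by force+
    then show ?thesis
      using f_mem[of i] that f(1,2) by auto
  qed
  have x_adj: "{x, f i} \<in> E \<longleftrightarrow> i = 0 \<or> i = n" if "i \<le> n" for i
    using f_inner[of i] far f(1,2) xa xb that by (metis le_neq_implies_less neq0_conv)
  have x_new: "f i \<noteq> x" if "i \<le> n" for i
    using f_inner[of i] far f(1,2) \<open>x \<noteq> a\<close> \<open>x \<noteq> b\<close> that by (metis le_neq_implies_less neq0_conv)
  have f_adj_less: "{f i, f j} \<in> E \<longleftrightarrow> j = Suc i" if "i < j" "j \<le> n" for i j
    using f(3)[of i] f(5)[of i j] f_mem[of i] f_mem[of j] that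
    by (cases "j = Suc i") (auto simp: R_def)
  have f_adj: "{f i, f j} \<in> E \<longleftrightarrow> j = Suc i \<or> i = Suc j" if "i \<le> n" "j \<le> n" for i j
    using f_adj_less[of i j] f_adj_less[of j i] that loop
    by (cases i j rule: linorder_cases) (auto simp: insert_commute)
  \<comment> \<open>Position 0 holds \<open>x\<close> and position \<open>Suc i\<close> holds
    \<open>f i\<close>, so the length is \<open>n + 2\<close> and the index wraps around only after
    position \<open>Suc n\<close>.\<close>
  define c where "c = x # map f [0..<Suc n]"
  have len: "length c = Suc (Suc n)"
    by (simp add: c_def)
  have c0: "c ! 0 = x"
    by (simp add: c_def)
  have cS: "c ! Suc i = f i" if "i \<le> n" for i
    using that unfolding c_def by (simp del: upt_Suc)
  have "{0..<Suc n} = {..n}"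
    by auto
  then have "distinct c"
    using f(4) x_new unfolding c_def by (auto simp del: upt_Suc simp: distinct_map)
  moreover have "{c ! p, c ! q} \<in> E \<longleftrightarrow> q = Suc p mod length c \<or> p = Suc q mod length c"
    if "p < length c" "q < length c" for p q
  proof -
    have sm: "Suc k mod length c = (if k = Suc n then 0 else Suc k)" if "k < length c" for k
      using that by (auto simp: len)
    show ?thesis
      unfolding sm[OF that(1)] sm[OF that(2)]
      using that n2 x_adj f_adj loop
      by (cases p; cases q) (auto simp: len c0 cS insert_commute less_Suc_eq_le split: if_splits)
  qed
  ultimately have "is_chordless_cycle E c"
    unfolding is_chordless_cycle_def using n2 len by auto
  then show False
    using chordal n2 len unfolding is_chordal_def by auto
qed

text \<open>
  Dirac's theorem on simplicial vertices. The stronger claim, with the simplicial vertex outside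
  the closed neighbourhood of \<open>x\<close>, is what makes the induction work: it is applied to a component
  \<open>C\<close> of the non-neighbours of \<open>x\<close> together with its attachment set \<open>T\<close>, which is a clique.
\<close>

lemma chordal_simplicial_vertex_avoiding:
  assumes chordal: "is_chordal E" and simple: "is_simple_graph E"
    and "finite S" "x \<in> S" "y \<in> S" "x \<noteq> y" "{x, y} \<notin> E"
  shows "\<exists>v\<in>S. v \<noteq> x \<and> {x, v} \<notin> E \<and> clique {u \<in> S. u = v \<or> {u, v} \<in> E} E"
  using assms(3-)
proof (induction "card S" arbitrary: S x y rule: less_induct)
  case less
  define W where "W = {v \<in> S. v \<noteq> x \<and> {x, v} \<notin> E}"
  define R where "R = {(u, v). u \<in> W \<and> v \<in> W \<and> {u, v} \<in> E}"
  define C where "C = {v. (y, v) \<in> R\<^sup>*}"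
  define T where "T = {t \<in> S - C. \<exists>c\<in>C. {t, c} \<in> E}"
  have "y \<in> W" "y \<in> C"
    using less.prems by (auto simp: W_def C_def)
  have CW: "C \<subseteq> W"
  proof
    fix v assume "v \<in> C"
    then have "(y, v) \<in> R\<^sup>*" by (simp add: C_def)
    then show "v \<in> W"
      by cases (use \<open>y \<in> W\<close> in \<open>auto simp: R_def\<close>)
  qed
  have C_closed: "t \<in> C" if "c \<in> C" "t \<in> W" "{t, c} \<in> E" for c t
  proof -
    have "(c, t) \<in> R"
      using that CW by (auto simp: R_def insert_commute)
    then show ?thesis
      using that(1) unfolding C_def by (auto intro: rtrancl_into_rtrancl)
  qed
  have Tx: "{x, t} \<in> E" if "t \<in> T" for t
    using that C_closed CW by (auto simp: T_def W_def insert_commute)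
  have "sym R"
    by (auto simp: R_def sym_def insert_commute)
  \<comment> \<open>The walks of \<open>R\<close> that join two vertices of \<open>C\<close> stay
    inside \<open>C\<close>; this is what supplies paths between attachment vertices with interior
    in \<open>C\<close>.\<close>
  have C_conn: "(c, d) \<in> {(u, v). u \<in> C \<and> v \<in> C \<and> {u, v} \<in> E}\<^sup>*" if "c \<in> C" "d \<in> C" for c d
  proof -
    have "(c, y) \<in> R\<^sup>*"
      using that \<open>sym R\<close> by (metis C_def mem_Collect_eq sym_rtrancl symD)
    then have "(c, d) \<in> R\<^sup>*"
      using that by (auto simp: C_def)
    then show ?thesis
    proof (induction rule: rtrancl_induct)
      case (step u v)
      have "(y, u) \<in> R\<^sup>*"
        using \<open>c \<in> C\<close> step.hyps(1) by (auto simp: C_def)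
      then have "u \<in> C" "v \<in> C"
        using step.hyps(2) by (auto simp: C_def intro: rtrancl_into_rtrancl)
      then show ?case
        using step by (auto simp: R_def intro: rtrancl_into_rtrancl)
    qed simp
  qed
  have T_clique: "{a, b} \<in> E" if ab: "a \<in> T" "b \<in> T" "a \<noteq> b" for a b
  proof (rule chordal_common_neighbour[OF chordal simple Tx[OF ab(1)] Tx[OF ab(2)] ab(3)])
    show "c \<noteq> x \<and> {x, c} \<notin> E" if "c \<in> C" for c
      using that CW by (auto simp: W_def)
    let ?R = "{(u, v). u \<in> insert a (insert b C) \<and> v \<in> insert a (insert b C) \<and> {u, v} \<in> E}"
    obtain c d where cd: "c \<in> C" "{a, c} \<in> E" "d \<in> C" "{b, d} \<in> E"
      using ab by (auto simp: T_def)
    have "(c, d) \<in> ?R\<^sup>*"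
      using C_conn[OF cd(1,3)] by (rule rtrancl_mono[THEN subsetD, rotated]) auto
    moreover have "(a, c) \<in> ?R" "(d, b) \<in> ?R"
      using cd by (auto simp: insert_commute)
    ultimately show "(a, b) \<in> ?R\<^sup>*"
      by (meson converse_rtrancl_into_rtrancl rtrancl_into_rtrancl)
  qed
  let ?P = "C \<union> T"
  have PS: "?P \<subseteq> S" "x \<notin> ?P"
    using CW Tx simple by (auto simp: T_def W_def is_simple_graph_def)
  then have card: "card ?P < card S"
    using less.prems by (intro psubset_card_mono) auto
  have fin: "finite ?P"
    using PS less.prems finite_subset by blast
  \<comment> \<open>By the choice of \<open>T\<close>, a vertex of \<open>C\<close> has no
    neighbours in \<open>S\<close> outside \<open>C \<union> T\<close>, so being simplicial in the
    smaller set suffices.\<close>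
  have nbhd: "{u \<in> S. u = v \<or> {u, v} \<in> E} = {u \<in> ?P. u = v \<or> {u, v} \<in> E}" if "v \<in> C" for v
    using that PS by (auto simp: T_def)
  have "\<exists>v\<in>C. clique {u \<in> ?P. u = v \<or> {u, v} \<in> E} E"
  \<comment> \<open>The induction hypothesis must return a vertex of \<open>C\<close>, not of
    \<open>T\<close>. If it avoids a vertex of \<open>T\<close>, this holds because \<open>T\<close>
    is a clique; if every vertex of \<open>T\<close> is adjacent to all others, it holds after
    avoiding any vertex of \<open>C\<close>. If neither applies, \<open>C \<union> T\<close> is a
    clique and \<open>y\<close> serves.\<close>
  proof (cases "\<exists>t\<in>T. \<exists>z\<in>?P. t \<noteq> z \<and> {t, z} \<notin> E")
    case True
    then obtain t z where tz: "t \<in> T" "z \<in> ?P" "t \<noteq> z" "{t, z} \<notin> E" by blast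
    then have "\<exists>v\<in>?P. v \<noteq> t \<and> {t, v} \<notin> E \<and> clique {u \<in> ?P. u = v \<or> {u, v} \<in> E} E"
      by (intro less.hyps[OF card fin]) auto
    then obtain v where v: "v \<in> ?P" "v \<noteq> t" "{t, v} \<notin> E"
      "clique {u \<in> ?P. u = v \<or> {u, v} \<in> E} E"
      by blast
    then have "v \<notin> T"
      using T_clique[OF tz(1)] by blast
    then show ?thesis
      using v by blast
  next
    case T_univ: False
    show ?thesis
    proof (cases "\<exists>c\<in>C. \<exists>z\<in>?P. c \<noteq> z \<and> {c, z} \<notin> E")
      case True
      then obtain c z where cz: "c \<in> C" "z \<in> ?P" "c \<noteq> z" "{c, z} \<notin> E" by blast
      then have "\<exists>v\<in>?P. v \<noteq> c \<and> {c, v} \<notin> E \<and> clique {u \<in> ?P. u = v \<or> {u, v} \<in> E} E"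
        by (intro less.hyps[OF card fin]) auto
      then obtain v where v: "v \<in> ?P" "v \<noteq> c" "{v, c} \<notin> E"
        "clique {u \<in> ?P. u = v \<or> {u, v} \<in> E} E"
        by (auto simp: insert_commute)
      then have "v \<notin> T"
        using T_univ cz(1) by blast
      then show ?thesis
        using v by blast
    next
      case False
      then have "clique ?P E"
        using T_univ unfolding clique_def by blast
      then show ?thesis
        using \<open>y \<in> C\<close> unfolding clique_def by blast
    qed
  qed
  then obtain v where "v \<in> C" "clique {u \<in> S. u = v \<or> {u, v} \<in> E} E"
    using nbhd by auto
  then show ?case
    using CW by (auto simp: W_def)
qed

lemma chordal_simplicial_vertex:
  assumes "is_chordal E" "is_simple_graph E" "finite S" "S \<noteq> {}"
  obtains v where "v \<in> S" "clique {u \<in> S. u = v \<or> {u, v} \<in> E} E"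
proof (cases "clique S E")
  case True
  obtain v where "v \<in> S"
    using assms(4) by blast
  moreover have "clique {u \<in> S. u = v \<or> {u, v} \<in> E} E"
    using True unfolding clique_def by blast
  ultimately show ?thesis
    by (rule that)
next
  case False
  then obtain x y where "x \<in> S" "y \<in> S" "x \<noteq> y" "{x, y} \<notin> E"
    unfolding clique_def by blast
  then show ?thesis
    using chordal_simplicial_vertex_avoiding[OF assms(1-3)] that by blast
qed

section \<open>Gram matrices and the image of the map\<close>

text \<open>A sum of rank-one matrices. The index type is left free because the summands are indexed
  by faces, by positions on a cycle, or by a single point.\<close>

definition gram :: "'k set \<Rightarrow> ('k \<Rightarrow> 'm \<Rightarrow> real) \<Rightarrow> real^'m^'m::finite" where
  "gram A f = (\<chi> i j. \<Sum>k\<in>A. f k i * f k j)"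

lemma gram_nth [simp]: "gram A f $ i $ j = (\<Sum>k\<in>A. f k i * f k j)"
  by (simp add: gram_def)

lemma quadratic_form_sum:
  fixes S :: "real^'m^'m::finite"
  shows "x \<bullet> (S *v x) = (\<Sum>i\<in>UNIV. \<Sum>j\<in>UNIV. x $ i * S $ i $ j * x $ j)"
  by (simp add: inner_vec_def matrix_vector_mult_def sum_distrib_left mult.assoc)

lemma quadratic_form_gram:
  "x \<bullet> (gram A f *v x) = (\<Sum>k\<in>A. (\<Sum>i\<in>UNIV. f k i * x $ i)\<^sup>2)"
proof -
  have "x \<bullet> (gram A f *v x) = (\<Sum>i\<in>UNIV. \<Sum>j\<in>UNIV. \<Sum>k\<in>A. (f k i * x $ i) * (f k j * x $ j))"
    by (simp add: quadratic_form_sum sum_distrib_left sum_distrib_right mult_ac)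
  also have "\<dots> = (\<Sum>i\<in>UNIV. \<Sum>k\<in>A. \<Sum>j\<in>UNIV. (f k i * x $ i) * (f k j * x $ j))"
    by (intro sum.cong refl sum.swap)
  also have "\<dots> = (\<Sum>k\<in>A. \<Sum>i\<in>UNIV. \<Sum>j\<in>UNIV. (f k i * x $ i) * (f k j * x $ j))"
    by (rule sum.swap)
  finally show ?thesis
    by (simp add: power2_eq_square sum_product)
qed

lemma gram_in_psd_cone: "gram A f \<in> psd_cone"
  unfolding psd_cone_def
  by (auto simp: quadratic_form_gram sum_nonneg vec_eq_iff transpose_def mult.commute)

text \<open>Evaluating both quadratic forms at \<open>x\<close> gives equal sums of squares; the one
  over \<open>A\<close> is zero, so every square over \<open>B\<close> is zero.\<close>

lemma gram_eq_orthogonal: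
  assumes eq: "gram A f = gram B g" and "finite B" "k \<in> B"
    and zero: "\<And>l. l \<in> A \<Longrightarrow> (\<Sum>i\<in>UNIV. f l i * x i) = 0"
  shows "(\<Sum>i\<in>UNIV. g k i * x i) = 0"
proof -
  have "(\<Sum>k\<in>B. (\<Sum>i\<in>UNIV. g k i * x i)\<^sup>2) = (\<Sum>l\<in>A. (\<Sum>i\<in>UNIV. f l i * x i)\<^sup>2)"
    using arg_cong[OF eq, of "\<lambda>M. (\<chi> i. x i) \<bullet> (M *v (\<chi> i. x i))"]
    by (simp add: quadratic_form_gram)
  also have "\<dots> = 0"
    using zero by simp
  finally show ?thesis
    using assms(2,3) by (simp add: sum_nonneg_eq_0_iff)
qed

text \<open>Trades the extensional parameters, which are \<open>undefined\<close> off their domains,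
  for total families that are zero there.\<close>

lemma image_phi_iff:
  "S \<in> phi \<Delta> ` param_space \<Delta> \<longleftrightarrow>
    (\<exists>g. (\<forall>F i. g F i \<noteq> 0 \<longrightarrow> F \<in> \<Delta> \<and> i \<in> F) \<and> S = gram UNIV g)"
proof
  assume "S \<in> phi \<Delta> ` param_space \<Delta>"
  then obtain \<gamma> where "S = phi \<Delta> \<gamma>" by blast
  then have "S = gram UNIV (\<lambda>F i. if F \<in> \<Delta> \<and> i \<in> F then \<gamma> F i else 0)"
    by (simp add: vec_eq_iff phi_def Gamma_matrix_def matrix_matrix_mult_def transpose_def)
  then show "\<exists>g. (\<forall>F i. g F i \<noteq> 0 \<longrightarrow> F \<in> \<Delta> \<and> i \<in> F) \<and> S = gram UNIV g"
    by (intro exI[of _ "\<lambda>F i. if F \<in> \<Delta> \<and> i \<in> F then \<gamma> F i else 0"]) auto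
next
  assume "\<exists>g. (\<forall>F i. g F i \<noteq> 0 \<longrightarrow> F \<in> \<Delta> \<and> i \<in> F) \<and> S = gram UNIV g"
  then obtain g where g: "\<And>F i. g F i \<noteq> 0 \<Longrightarrow> F \<in> \<Delta> \<and> i \<in> F" "S = gram UNIV g" by blast
  define \<gamma> where "\<gamma> = (\<lambda>F\<in>\<Delta>. restrict (g F) F)"
  have "\<gamma> \<in> param_space \<Delta>"
    unfolding \<gamma>_def param_space_def by auto
  moreover have "(if F \<in> \<Delta> \<and> i \<in> F then \<gamma> F i else 0) = g F i" for F i
    using g(1)[of F i] by (auto simp: \<gamma>_def)
  then have "S = phi \<Delta> \<gamma>"
    by (simp add: g(2) vec_eq_iff phi_def Gamma_matrix_def matrix_matrix_mult_def transpose_def)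
  ultimately show "S \<in> phi \<Delta> ` param_space \<Delta>" by blast
qed

section \<open>Schur complements and elimination along a chordal graph\<close>

lemma psd_cone_sym: "S \<in> psd_cone \<Longrightarrow> S $ i $ j = S $ j $ i"
  by (metis (mono_tags) psd_cone_def mem_Collect_eq transpose_def vec_lambda_beta)

lemma psd_cone_diag_nonneg: "S \<in> psd_cone \<Longrightarrow> 0 \<le> S $ v $ v"
  unfolding psd_cone_def
  by (auto dest!: spec[of _ "axis v 1"] simp: inner_axis' matrix_vector_mult_basis column_def)

lemma quadratic_nonneg_discriminant:
  fixes d :: real
  assumes "\<And>t. 0 \<le> q + 2 * t * b + t\<^sup>2 * d" "0 \<le> d"
  shows "b\<^sup>2 \<le> d * q"
proof (cases "d = 0")
  case True
  then have "b = 0"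
    \<comment> \<open>At this \<open>t\<close> the affine function takes the value -1. For nonzero
      \<open>d\<close>, the choice \<open>- b / d\<close> below is the minimiser.\<close>
    using assms(1)[of "- (q + 1) / (2 * b)"] by (cases "b = 0") (auto simp: field_simps)
  then show ?thesis
    using True by simp
next
  case False
  then show ?thesis
    using assms(1)[of "- b / d"] assms(2) by (simp add: field_simps power2_eq_square)
qed

text \<open>The quadratic form at \<open>x + t e_v\<close> is a nonnegative quadratic polynomial in
  \<open>t\<close> with leading coefficient \<open>S $ v $ v\<close>.\<close>

lemma psd_cone_cauchy_schwarz:
  fixes S :: "real^'m^'m::finite"
  assumes "S \<in> psd_cone"
  shows "((S *v x) $ v)\<^sup>2 \<le> S $ v $ v * (x \<bullet> (S *v x))"
proof (rule quadratic_nonneg_discriminant)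
  fix t
  have "transpose S = S"
    using assms by (simp add: psd_cone_def)
  then have sym: "x \<bullet> (S *v axis v 1) = axis v 1 \<bullet> (S *v x)"
    by (metis dot_lmul_matrix inner_commute vector_transpose_matrix)
  have "0 \<le> (x + t *\<^sub>R axis v 1) \<bullet> (S *v (x + t *\<^sub>R axis v 1))"
    using assms by (simp add: psd_cone_def)
  also have "\<dots> = x \<bullet> (S *v x) + 2 * t * (S *v x) $ v + t\<^sup>2 * (S *v axis v 1) $ v"
    using sym by (simp add: matrix_vector_right_distrib matrix_vector_mult_scaleR
        inner_add_left inner_add_right inner_axis' power2_eq_square algebra_simps)
  also have "(S *v axis v 1) $ v = S $ v $ v"
    by (simp add: matrix_vector_mult_basis column_def)
  finally show "0 \<le> x \<bullet> (S *v x) + 2 * t * (S *v x) $ v + t\<^sup>2 * S $ v $ v" .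
  show "0 \<le> S $ v $ v"
    using assms by (rule psd_cone_diag_nonneg)
qed

text \<open>
  If \<open>S $ v $ v = 0\<close>, then the division by zero makes the Schur complement equal to \<open>S\<close>, whose
  \<open>v\<close>-th row is zero in this case; so the pivot may vanish.
\<close>

definition schur_complement :: "'m \<Rightarrow> real^'m^'m \<Rightarrow> real^'m^'m::finite" where
  "schur_complement v S = (\<chi> i j. S $ i $ j - S $ i $ v * S $ v $ j / S $ v $ v)"

lemma schur_complement_nth [simp]:
  "schur_complement v S $ i $ j = S $ i $ j - S $ i $ v * S $ v $ j / S $ v $ v"
  by (simp add: schur_complement_def)

text \<open>Cauchy-Schwarz at the basis vector \<open>e_j\<close> bounds the square of the entry by
  a multiple of the zero pivot.\<close>

lemma psd_cone_zero_row:
  assumes "S \<in> psd_cone" "S $ v $ v = 0"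
  shows "S $ v $ j = 0"
  using psd_cone_cauchy_schwarz[OF assms(1), of "axis j 1" v] assms(2)
  by (simp add: matrix_vector_mult_basis column_def)

text \<open>Its quadratic form is that of \<open>S\<close> minus
  \<open>((S *v x) $ v)\<^sup>2 / S $ v $ v\<close>, which Cauchy-Schwarz bounds by the form of
  \<open>S\<close>.\<close>

lemma schur_complement_psd:
  fixes S :: "real^'m^'m::finite"
  assumes S: "S \<in> psd_cone"
  shows "schur_complement v S \<in> psd_cone"
proof -
  have "0 \<le> x \<bullet> (schur_complement v S *v x)" for x
  proof -
    have "x \<bullet> (schur_complement v S *v x) = x \<bullet> (S *v x) -
      (\<Sum>i\<in>UNIV. \<Sum>j\<in>UNIV. (S $ v $ i * x $ i) * (S $ v $ j * x $ j) / S $ v $ v)"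
      unfolding quadratic_form_sum sum_subtractf[symmetric]
    proof (intro sum.cong refl)
      fix i j
      show "x $ i * schur_complement v S $ i $ j * x $ j = x $ i * S $ i $ j * x $ j -
          (S $ v $ i * x $ i) * (S $ v $ j * x $ j) / S $ v $ v"
        using psd_cone_sym[OF S, of i v] by (simp add: algebra_simps)
    qed
    also have "\<dots> = x \<bullet> (S *v x) - ((S *v x) $ v)\<^sup>2 / S $ v $ v"
      by (simp add: matrix_vector_mult_def power2_eq_square sum_product sum_divide_distrib)
    finally have "x \<bullet> (schur_complement v S *v x) =
      x \<bullet> (S *v x) - ((S *v x) $ v)\<^sup>2 / S $ v $ v" .
    moreover have "((S *v x) $ v)\<^sup>2 / S $ v $ v \<le> x \<bullet> (S *v x)"
    proof (cases "S $ v $ v = 0")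
      case True
      then show ?thesis
        using S by (simp add: psd_cone_def)
    next
      case False
      then have "0 < S $ v $ v"
        using psd_cone_diag_nonneg[OF S, of v] by simp
      then show ?thesis
        using psd_cone_cauchy_schwarz[OF S, of x v] by (simp add: field_simps)
    qed
    ultimately show ?thesis by simp
  qed
  moreover have "schur_complement v S $ j $ i = schur_complement v S $ i $ j" for i j
    unfolding schur_complement_nth by (metis psd_cone_sym[OF S] mult.commute)
  ultimately show ?thesis
    by (simp add: psd_cone_def vec_eq_iff transpose_def)
qed

text \<open>
  Cholesky elimination along a perfect elimination ordering: the faces used after eliminating \<open>v\<close>
  avoid \<open>v\<close>, so the column of the eliminated vertex gets a face of its own.
\<close>

lemma chordal_psd_decomposition:
  fixes E :: "'m::finite set set"
  assumes "is_chordal E" "is_simple_graph E" "M \<in> psd_cone_graph E"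
    and "\<And>i j. i \<notin> V \<Longrightarrow> M $ i $ j = 0"
  shows "\<exists>g. (\<forall>F i. g F i \<noteq> 0 \<longrightarrow> clique F E \<and> F \<subseteq> V \<and> i \<in> F) \<and> M = gram UNIV g"
  using assms(3-)
proof (induction "card V" arbitrary: V M)
  case 0
  then have "M = gram UNIV (\<lambda>F i. 0)"
    by (simp add: vec_eq_iff)
  then show ?case
    by (intro exI[of _ "\<lambda>F i. 0"]) auto
next
  case (Suc n)
  have "V \<noteq> {}"
    using Suc.hyps(2) by auto
  then obtain v where v: "v \<in> V" "clique {u \<in> V. u = v \<or> {u, v} \<in> E} E"
    using chordal_simplicial_vertex[OF assms(1,2) finite] by blast
  define H where "H = {u \<in> V. u = v \<or> {u, v} \<in> E}"
  \<comment> \<open>The Cholesky column of \<open>v\<close>: \<open>h h^T\<close> is what the Schur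
    complement subtracts. A zero pivot makes \<open>h\<close> zero.\<close>
  define h where "h i = M $ i $ v / sqrt (M $ v $ v)" for i
  have M: "M \<in> psd_cone" and pattern: "\<And>i j. i \<noteq> j \<Longrightarrow> {i, j} \<notin> E \<Longrightarrow> M $ i $ j = 0"
    using Suc.prems(1) by (auto simp: psd_cone_graph_def)
  have h_H: "i \<in> H" if "M $ i $ v \<noteq> 0" for i
    using that pattern[of i v] Suc.prems(2)[of i v] by (auto simp: H_def)
  have hh: "h i * h j = M $ i $ v * M $ v $ j / M $ v $ v" for i j
    using psd_cone_diag_nonneg[OF M, of v] psd_cone_sym[OF M, of j v] by (simp add: h_def)
  let ?N = "schur_complement v M"
  have "?N $ i $ j = 0" if "i \<noteq> j" "{i, j} \<notin> E" for i j
  proof -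
    \<comment> \<open>There is no fill-in: the support of \<open>h\<close> lies in the clique
      \<open>H\<close>, which cannot contain two distinct nonadjacent vertices.\<close>
    have "M $ i $ v = 0 \<or> M $ v $ j = 0"
      using v(2) that h_H[of i] h_H[of j] psd_cone_sym[OF M, of j v]
      unfolding clique_def H_def[symmetric] by auto
    then show ?thesis
      using pattern that by auto
  qed
  then have N: "?N \<in> psd_cone_graph E"
    using schur_complement_psd[OF M] by (simp add: psd_cone_graph_def)
  have N0: "?N $ i $ j = 0" if "i \<notin> V - {v}" for i j
    using that Suc.prems(2) psd_cone_zero_row[OF M, of v j] by auto
  have "n = card (V - {v})"
    using Suc.hyps(2) v(1) by simp
  from Suc.hyps(1)[OF this N N0] obtain g where
    g: "\<And>F i. g F i \<noteq> 0 \<Longrightarrow> clique F E \<and> F \<subseteq> V - {v} \<and> i \<in> F" "?N = gram UNIV g"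
    by blast
  have gH: "g H i = 0" for i
    using g(1)[of H i] v(1) by (auto simp: H_def)
  have "M = gram UNIV (g(H := h))"
  proof -
    have "M $ i $ j = (\<Sum>F\<in>UNIV. (g(H := h)) F i * (g(H := h)) F j)" for i j
    proof -
      have "M $ i $ j = (\<Sum>F\<in>UNIV. g F i * g F j) + h i * h j"
        using arg_cong[OF g(2), of "\<lambda>X. X $ i $ j"] hh by simp
      also have "(\<Sum>F\<in>UNIV. g F i * g F j) = (\<Sum>F\<in>UNIV - {H}. g F i * g F j)"
        by (simp add: sum.remove[of UNIV H] gH)
      finally show ?thesis
        by (simp add: sum.remove[of UNIV H])
    qed
    then show ?thesis
      by (simp add: vec_eq_iff)
  qed
  moreover have "clique F E \<and> F \<subseteq> V \<and> i \<in> F" if "(g(H := h)) F i \<noteq> 0" for F i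
  proof (cases "F = H")
    case True
    then show ?thesis
      using that v(2) h_H[of i] unfolding H_def[symmetric] by (auto simp: h_def H_def)
  next
    case False
    then show ?thesis
      using that g(1)[of F i] by auto
  qed
  ultimately show ?case by blast
qed

section \<open>The obstruction from a chordless cycle\<close>

text \<open>Moves inner products over all vertices to sums over positions of the cycle.\<close>

lemma sum_list_supported:
  fixes h :: "'m::finite \<Rightarrow> real"
  shows "(\<Sum>i\<in>UNIV. h i * (\<Sum>a<n. if c ! a = i then t a else 0)) = (\<Sum>a<n. h (c ! a) * t a)"
proof -
  have "(\<Sum>i\<in>UNIV. h i * (\<Sum>a<n. if c ! a = i then t a else 0))
    = (\<Sum>a<n. \<Sum>i\<in>UNIV. h i * (if c ! a = i then t a else 0))"
    by (subst sum.swap) (simp add: sum_distrib_left)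
  also have "\<dots> = (\<Sum>a<n. h (c ! a) * t a)"
    by (simp add: if_distrib[of "\<lambda>z. h _ * z"] cong: if_cong)
  finally show ?thesis .
qed

text \<open>
  The rows \<open>r k = e\<^sub>k + e\<^sub>k\<^sub>+\<^sub>1 + (-1)\<^sup>k e\<^sub>L\<close>, where \<open>L\<close> is the last position of the cycle: in their
  Gram matrix the entries between \<open>L\<close> and the inner positions cancel. The vectors \<open>u\<close> and \<open>w\<close>
  below span the kernel on the cycle, and a clique contains \<open>L\<close> together with at most one of its
  two neighbours, which forces a vector supported on it and orthogonal to the kernel to vanish
  at \<open>L\<close>.
\<close>

lemma chordless_cycle_not_decomposable:
  fixes E :: "'m::finite set set"
  assumes cyc: "is_chordless_cycle E c" and len: "3 < length c"
  obtains M where "M \<in> psd_cone_graph E"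
    "\<And>g. (\<And>F i. g F i \<noteq> 0 \<Longrightarrow> clique F E \<and> i \<in> F) \<Longrightarrow> M \<noteq> gram UNIV g"
proof -
  define L where "L = length c - 1"
  have L: "length c = Suc L" "3 \<le> L"
    using len by (auto simp: L_def)
  have dist: "distinct c"
    using cyc by (simp add: is_chordless_cycle_def)
  have nth_inj: "c ! a = c ! b \<longleftrightarrow> a = b" if "a \<le> L" "b \<le> L" for a b
    using nth_eq_iff_index_eq[OF dist] that L by auto
  have adj: "{c ! a, c ! b} \<in> E \<longleftrightarrow> b = Suc a mod Suc L \<or> a = Suc b mod Suc L"
    if "a \<le> L" "b \<le> L" for a b
    using cyc that L by (simp add: is_chordless_cycle_def)
  \<comment> \<open>Only \<open>k < L - 1\<close> is used, so \<open>Suc k < L\<close> and the three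
    nonzero positions are distinct.\<close>
  define t where "t k a = (if a = k \<or> a = Suc k then 1 else if a = L then (-1) ^ k else (0::real))"
    for k a :: nat
  define r where "r k i = (\<Sum>a<Suc L. if c ! a = i then t k a else 0)" for k i
  define M where "M = gram {..<L - 1} r"
  have r_nth: "r k (c ! a) = t k a" if "a \<le> L" for k a
  proof -
    have "r k (c ! a) = (\<Sum>b<Suc L. if b = a then t k b else 0)"
      unfolding r_def using that nth_inj by (intro sum.cong) auto
    then show ?thesis
      using that by simp
  qed
  have r_out: "r k i = 0" if "i \<notin> set c" for k i
    unfolding r_def using that L by (intro sum.neutral) (auto dest: nth_mem)
  have M_zero: "(\<Sum>k<L - 1. t k a * t k b) = 0"
    if "a < b" "b \<le> L" "{c ! a, c ! b} \<notin> E" for a b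
  proof (cases "b = L")
    case False
    then have "b \<noteq> Suc a"
      using that adj[of a b] by auto
    then show ?thesis
      using that False by (intro sum.neutral) (auto simp: t_def)
  next
    case True
    then have a: "0 < a" "Suc a < L"
      using that adj[of a L] by (auto intro: Suc_lessI gr0I)
    \<comment> \<open>Only the rows \<open>a\<close> and \<open>a - 1\<close> are nonzero at
      \<open>a\<close>; their signs at \<open>L\<close> are opposite.\<close>
    have "(\<Sum>k<L - 1. t k a * t k L) =
        (\<Sum>k<L - 1. (if k = a then (-1) ^ a else 0) + (if k = a - 1 then - ((-1) ^ a) else 0))"
      using a by (cases a) (auto simp: t_def intro!: sum.cong)
    also have "\<dots> = 0"
      using a by (simp add: sum.distrib)
    finally show ?thesis
      using True by simp
  qed
  have "M \<in> psd_cone_graph E"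
    unfolding psd_cone_graph_def
  proof (intro CollectI conjI allI impI)
    show "M \<in> psd_cone"
      unfolding M_def by (rule gram_in_psd_cone)
    fix i j assume ij: "i \<noteq> j \<and> {i, j} \<notin> E"
    show "M $ i $ j = 0"
    proof (cases "i \<in> set c \<and> j \<in> set c")
      case True
      then obtain a b where ab: "i = c ! a" "a \<le> L" "j = c ! b" "b \<le> L"
        using L by (auto simp: in_set_conv_nth less_Suc_eq_le)
      then have "M $ i $ j = (\<Sum>k<L - 1. t k a * t k b)"
        by (simp add: M_def r_nth)
      also have "\<dots> = 0"
      proof (cases a b rule: linorder_cases)
        case less
        then show ?thesis
          using ab ij M_zero[of a b] by simp
      next
        case equal
        then show ?thesis
          using ab ij by simp
      next
        case greater
        then show ?thesis
          using ab ij M_zero[of b a] by (simp add: insert_commute mult.commute)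
      qed
      finally show ?thesis .
    next
      case False
      then show ?thesis
        by (auto simp: M_def r_out)
    qed
  qed
  moreover have "M \<noteq> gram UNIV g" if g: "\<And>F i. g F i \<noteq> 0 \<Longrightarrow> clique F E \<and> i \<in> F" for g
  proof
    assume eq: "M = gram UNIV g"
    have "M $ (c ! L) $ (c ! L) = (\<Sum>k<L - 1. t k L * t k L)"
      by (simp add: M_def r_nth)
    also have "\<dots> = (\<Sum>k<L - 1. 1)"
      by (intro sum.cong) (auto simp: t_def simp flip: power_add)
    also have "\<dots> \<noteq> 0"
      using L by simp
    finally have "(\<Sum>F\<in>UNIV. g F (c ! L) * g F (c ! L)) \<noteq> 0"
      using eq by simp
    then obtain F where F: "g F (c ! L) \<noteq> 0"
      by (metis (no_types, lifting) mult_eq_0_iff sum.neutral)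
    then have clF: "clique F E" "c ! L \<in> F"
      using g by auto
    have orth: "(\<Sum>a<Suc L. g F (c ! a) * x a) = 0"
      if "\<And>k. k < L - 1 \<Longrightarrow> (\<Sum>a<Suc L. t k a * x a) = 0" for x
    proof -
      have "(\<Sum>i\<in>UNIV. g F i * (\<Sum>a<Suc L. if c ! a = i then x a else 0)) = 0"
      proof (rule gram_eq_orthogonal)
        show "gram {..<L - 1} r = gram UNIV g"
          using eq by (simp add: M_def)
        fix k assume "k \<in> {..<L - 1}"
        then show "(\<Sum>i\<in>UNIV. r k i * (\<Sum>a<Suc L. if c ! a = i then x a else 0)) = 0"
          unfolding sum_list_supported using that[of k] by (simp add: r_nth)
      qed auto
      then show ?thesis
        unfolding sum_list_supported .
    qed
    have t_sum: "(\<Sum>a<Suc L. t k a * x a) = x k + x (Suc k) + (-1) ^ k * x L"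
      if "k < L - 1" for k x
    proof -
      have "(\<Sum>a<Suc L. t k a * x a) = (\<Sum>a<Suc L. (if a = k then x a else 0) +
          (if a = Suc k then x a else 0) + (if a = L then (-1) ^ k * x a else 0))"
        using that by (intro sum.cong) (auto simp: t_def)
      also have "\<dots> = x k + x (Suc k) + (-1) ^ k * x L"
        using that by (auto simp: sum.distrib)
      finally show ?thesis .
    qed
    \<comment> \<open>The clique \<open>F\<close> contains \<open>c ! L\<close>, so it meets the
      cycle besides in at most the two neighbours at positions 0 and \<open>L - 1\<close>.\<close>
    have g_sum: "(\<Sum>a<Suc L. g F (c ! a) * x a) =
        g F (c ! 0) * x 0 + g F (c ! (L - 1)) * x (L - 1) + g F (c ! L) * x L" for x
    proof -
      have "g F (c ! a) = 0" if "a < L" "a \<noteq> 0" "a \<noteq> L - 1" for a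
      proof (rule ccontr)
        assume "g F (c ! a) \<noteq> 0"
        then have "c ! a \<in> F"
          using g by auto
        then have "{c ! a, c ! L} \<in> E"
          using clF nth_inj[of a L] that by (auto simp: clique_def)
        then show False
          using that adj[of a L] by auto
      qed
      then have "(\<Sum>a<Suc L. g F (c ! a) * x a) = (\<Sum>a\<in>{0, L - 1, L}. g F (c ! a) * x a)"
        using L by (intro sum.mono_neutral_right) (auto simp: less_Suc_eq)
      then show ?thesis
        using L by simp
    qed
    \<comment> \<open>Orthogonality to the rows is the recurrence
      \<open>x (k + 1) = - x k - (-1)^k * x L\<close>. The solution \<open>u\<close> starts from
      \<open>x 0 = 1\<close>, \<open>x L = 0\<close>, and \<open>w\<close> from
      \<open>x 0 = 0\<close>, \<open>x L = 1\<close>.\<close>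
    define u where "u a = (if a = L then 0 else (-1) ^ a :: real)" for a :: nat
    define w where "w a = (if a = L then 1 else (-1) ^ a * real a)" for a :: nat
    have "(\<Sum>a<Suc L. g F (c ! a) * u a) = 0"
      by (rule orth, subst t_sum) (auto simp: u_def)
    then have u0: "g F (c ! 0) + g F (c ! (L - 1)) * (-1) ^ (L - 1) = 0"
      using L unfolding g_sum by (auto simp: u_def split: if_splits)
    have "(\<Sum>a<Suc L. g F (c ! a) * w a) = 0"
      by (rule orth, subst t_sum) (auto simp: w_def algebra_simps)
    then have w0: "g F (c ! (L - 1)) * ((-1) ^ (L - 1) * real (L - 1)) + g F (c ! L) = 0"
      using L unfolding g_sum by (auto simp: w_def split: if_splits)
    \<comment> \<open>Positions 0 and \<open>L - 1\<close> are not adjacent because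
      \<open>L \<ge> 3\<close>. With one of the two values zero, \<open>u\<close> makes the other
      zero and \<open>w\<close> then makes the value at \<open>L\<close> zero.\<close>
    have "g F (c ! 0) = 0 \<or> g F (c ! (L - 1)) = 0"
    proof (rule ccontr)
      assume "\<not> ?thesis"
      then have "c ! 0 \<in> F" "c ! (L - 1) \<in> F"
        using g by auto
      then have "{c ! 0, c ! (L - 1)} \<in> E"
        using clF nth_inj[of 0 "L - 1"] L by (auto simp: clique_def)
      then show False
        using adj[of 0 "L - 1"] L by auto
    qed
    then have "g F (c ! (L - 1)) = 0"
      using u0 by auto
    then show False
      using w0 F by simp
  qed
  ultimately show ?thesis
    using that by blast
qed

section \<open>Recovering the complex from the image\<close>

text \<open>Giving the single face \<open>F\<close> the all-ones vector produces a matrix in the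
  image with no zero entry on \<open>F\<close>, so the zero pattern makes \<open>F\<close> a
  clique.\<close>

lemma subset_clique_complex_if_image_phi_subset:
  fixes \<Delta> E :: "'m::finite set set"
  assumes "phi \<Delta> ` param_space \<Delta> \<subseteq> psd_cone_graph E"
  shows "\<Delta> \<subseteq> clique_complex E"
proof
  fix F assume F: "F \<in> \<Delta>"
  define g :: "'m set \<Rightarrow> 'm \<Rightarrow> real" where "g H i = (if H = F \<and> i \<in> F then 1 else 0)" for H i
  have "gram UNIV g \<in> phi \<Delta> ` param_space \<Delta>"
    unfolding image_phi_iff using F by (intro exI[of _ g]) (auto simp: g_def)
  then have "gram UNIV g \<in> psd_cone_graph E"
    using assms by blast
  then have pattern: "gram UNIV g $ i $ j = 0" if "i \<noteq> j" "{i, j} \<notin> E" for i j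
    using that by (simp add: psd_cone_graph_def)
  have "gram UNIV g $ i $ j = 1" if "i \<in> F" "j \<in> F" for i j
    using that by (simp add: g_def if_distrib cong: if_cong)
  then show "F \<in> clique_complex E"
    using pattern unfolding clique_complex_def clique_def by fastforce
qed

text \<open>The indicator vector of a clique \<open>F\<close> gives a rank-one matrix in the cone.
  Every summand of a decomposition of it is constant on \<open>F\<close>, so one that is nonzero
  somewhere on \<open>F\<close> has a face containing \<open>F\<close>.\<close>

lemma clique_complex_subset_if_subset_image_phi:
  fixes \<Delta> E :: "'m::finite set set"
  assumes "is_simplicial_complex \<Delta>" and surj: "psd_cone_graph E \<subseteq> phi \<Delta> ` param_space \<Delta>"
  shows "clique_complex E \<subseteq> \<Delta>"
proof
  fix F assume "F \<in> clique_complex E"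
  then have F: "clique F E"
    by (simp add: clique_complex_def)
  have down: "F' \<in> \<Delta>" if "H \<in> \<Delta>" "F' \<subseteq> H" for H F'
    using assms(1) that by (auto simp: is_simplicial_complex_def)
  define f :: "unit \<Rightarrow> 'm \<Rightarrow> real" where "f k i = (if i \<in> F then 1 else 0)" for k i
  have "gram UNIV f \<in> psd_cone_graph E"
    using F gram_in_psd_cone by (auto simp: psd_cone_graph_def f_def clique_def UNIV_unit)
  then have "gram UNIV f \<in> phi \<Delta> ` param_space \<Delta>"
    using surj by blast
  then obtain g where g: "\<And>H i. g H i \<noteq> 0 \<Longrightarrow> H \<in> \<Delta> \<and> i \<in> H" "gram UNIV f = gram UNIV g"
    unfolding image_phi_iff by blast
  show "F \<in> \<Delta>"
  \<comment> \<open>The empty clique leaves no nonzero entry to exploit; it is a face because some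
    face exists.\<close>
  proof (cases "F = {}")
    case True
    then show ?thesis
      using assms(1) down by (metis UNIV_I UnionE empty_subsetI is_simplicial_complex_def)
  next
    case False
    then obtain i where i: "i \<in> F" by blast
    then have "gram UNIV g $ i $ i \<noteq> 0"
      unfolding g(2)[symmetric] by (simp add: f_def UNIV_unit)
    then obtain H where H: "g H i \<noteq> 0"
      unfolding gram_nth by (metis (no_types, lifting) mult_eq_0_iff sum.neutral)
    have "g H j = g H i" if "j \<in> F" for j
    proof -
      \<comment> \<open>The vector \<open>e_i - e_j\<close> is orthogonal to the indicator of
        \<open>F\<close>.\<close>
      define x where "x k = (if k = i then 1 else 0) - (if k = j then 1 else (0::real))" for k
      have x: "(\<Sum>k\<in>UNIV. h k * x k) = h i - h j" for h
        by (simp add: x_def right_diff_distrib sum_subtractf if_distrib[of "\<lambda>z. h _ * z"] cong: if_cong)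
      have "(\<Sum>k\<in>UNIV. g H k * x k) = 0"
        by (rule gram_eq_orthogonal[OF g(2)]) (use i that in \<open>auto simp: x f_def\<close>)
      then show ?thesis
        by (simp add: x)
    qed
    then have "F \<subseteq> H" "H \<in> \<Delta>"
      using g(1) H by (metis subsetI, blast)
    then show ?thesis
      using down by blast
  qed
qed

theorem corollary3p2:
  fixes \<Delta> E :: "'m::finite set set"
  assumes "is_simplicial_complex \<Delta>" and "is_simple_graph E"
  shows "phi \<Delta> ` param_space \<Delta> = psd_cone_graph E \<longleftrightarrow> is_chordal E \<and> \<Delta> = clique_complex E"
proof
  assume im: "phi \<Delta> ` param_space \<Delta> = psd_cone_graph E"
  have \<Delta>: "\<Delta> = clique_complex E"
    using subset_clique_complex_if_image_phi_subset[of \<Delta> E]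
      clique_complex_subset_if_subset_image_phi[OF assms(1), of E] im by auto
  have "is_chordal E"
    unfolding is_chordal_def
  proof
    assume "\<exists>c. is_chordless_cycle E c \<and> 3 < length c"
    then obtain M where M: "M \<in> psd_cone_graph E"
      "\<And>g. (\<And>F i. g F i \<noteq> 0 \<Longrightarrow> clique F E \<and> i \<in> F) \<Longrightarrow> M \<noteq> gram UNIV g"
      using chordless_cycle_not_decomposable by metis
    then have "M \<in> phi \<Delta> ` param_space \<Delta>"
      using im by simp
    then show False
      unfolding image_phi_iff \<Delta> clique_complex_def using M(2) by auto
  qed
  with \<Delta> show "is_chordal E \<and> \<Delta> = clique_complex E" by blast
next
  assume R: "is_chordal E \<and> \<Delta> = clique_complex E"
  show "phi \<Delta> ` param_space \<Delta> = psd_cone_graph E"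
  proof
    show "phi \<Delta> ` param_space \<Delta> \<subseteq> psd_cone_graph E"
    proof
      fix M assume "M \<in> phi \<Delta> ` param_space \<Delta>"
      then obtain g where g: "\<And>F i. g F i \<noteq> 0 \<Longrightarrow> clique F E \<and> i \<in> F" "M = gram UNIV g"
        unfolding image_phi_iff using R by (auto simp: clique_complex_def)
      \<comment> \<open>A nonzero product would put \<open>i\<close> and \<open>j\<close> in a
        common clique.\<close>
      have "M $ i $ j = 0" if "i \<noteq> j" "{i, j} \<notin> E" for i j
        unfolding g(2) gram_nth
      proof (intro sum.neutral ballI)
        fix F
        show "g F i * g F j = 0"
          using g(1)[of F i] g(1)[of F j] that by (auto simp: clique_def)
      qed
      then show "M \<in> psd_cone_graph E"
        using g(2) gram_in_psd_cone by (auto simp: psd_cone_graph_def)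
    qed
    show "psd_cone_graph E \<subseteq> phi \<Delta> ` param_space \<Delta>"
    proof
      fix M assume "M \<in> psd_cone_graph E"
      \<comment> \<open>Elimination starts from all vertices, where the condition on rows outside
        \<open>V\<close> is void.\<close>
      then have "\<exists>g. (\<forall>F i. g F i \<noteq> 0 \<longrightarrow> clique F E \<and> F \<subseteq> UNIV \<and> i \<in> F) \<and> M = gram UNIV g"
        using R assms(2) by (intro chordal_psd_decomposition) auto
      then show "M \<in> phi \<Delta> ` param_space \<Delta>"
        unfolding image_phi_iff using R by (auto simp: clique_complex_def)
    qed
  qed
qed

end
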